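(* Let $A,B,C\in \mathbb{C}_{n,n}$ be such that $A_{(B,C)}^{D}$ exists with $k\in {\rm I}_{(B,C)}(A)$. Then, for any given $b\in\mathbb{C}^{n}$, $x=A_{(B,C)}^{D}b$ is the unique solution to $$\min \|CAx-b\|_{2}\quad\text{subject to}\quad x\in \mathcal{R}((CA)^{k}B).$$
   Context: $\mathbb{N}=\{0,1,2,\dots\}$. $\mathbb{C}_{n,n}$ is the ring of all $n\times n$ complex matrices with involution $*$ the conjugate transpose. $\mathcal{R}(M)$ is the range (column space) of $M$ and $\|\cdot\|_2$ is the Euclidean norm on $\mathbb{C}^n$. Write $S=\mathbb{C}_{n,n}$. $A$ is $(B,C)$-core-EP invertible if there exist $X\in S$ and $k\in\mathbb{N}$ such that $CAX(CA)^{k}C=(CA)^{k}C$, $XS=(CA)^{k}BS$ and $SX=S((CA)^{k}C)^{*}$; ${\rm I}_{(B,C)}(A)$ is the set of all $k\in\mathbb{N}$ for which such an $X$ exists. For the given $k\in{\rm I}_{(B,C)}(A)$, $A_{(B,C)}^{D}$ denotes the matrix $X$ satisfying these conditions with that $k$. *)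

theory Defs
  imports "HOL-Analysis.Analysis"
begin

definition conj_transpose :: "complex ^ 'n ^ 'm \<Rightarrow> complex ^ 'm ^ 'n" where
  "conj_transpose M = (\<chi> i j. cnj (M $ j $ i))"

(* The library's power operator on vectors and matrices is the entrywise power,
   hence a separate power with respect to the matrix product. *)
primrec matrix_power :: "complex ^ 'n ^ 'n \<Rightarrow> nat \<Rightarrow> complex ^ 'n ^ 'n" where
  "matrix_power M 0 = mat 1"
| "matrix_power M (Suc k) = M ** matrix_power M k"

definition mat_range :: "complex ^ 'n ^ 'm \<Rightarrow> (complex ^ 'm) set" where
  "mat_range M = range (\<lambda>v. M *v v)"

(* M S and S M for the ring S of all square matrices *)
definition right_ideal_of :: "complex ^ 'n ^ 'n \<Rightarrow> (complex ^ 'n ^ 'n) set" where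
  "right_ideal_of M = range (\<lambda>Y. M ** Y)"

definition left_ideal_of :: "complex ^ 'n ^ 'n \<Rightarrow> (complex ^ 'n ^ 'n) set" where
  "left_ideal_of M = range (\<lambda>Y. Y ** M)"

definition is_BC_core_EP_inverse ::
  "complex ^ 'n ^ 'n \<Rightarrow> complex ^ 'n ^ 'n \<Rightarrow> complex ^ 'n ^ 'n \<Rightarrow> nat \<Rightarrow>
    complex ^ 'n ^ 'n \<Rightarrow> bool" where
  "is_BC_core_EP_inverse A B C k X \<longleftrightarrow>
     C ** A ** X ** matrix_power (C ** A) k ** C = matrix_power (C ** A) k ** C \<and>
     right_ideal_of X = right_ideal_of (matrix_power (C ** A) k ** B) \<and>
     left_ideal_of X = left_ideal_of (conj_transpose (matrix_power (C ** A) k ** C))"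

definition BC_core_EP_indices ::
  "complex ^ 'n ^ 'n \<Rightarrow> complex ^ 'n ^ 'n \<Rightarrow> complex ^ 'n ^ 'n \<Rightarrow> nat set" where
  "BC_core_EP_indices A B C = {k. \<exists>X. is_BC_core_EP_inverse A B C k X}"

(* For k in BC_core_EP_indices A B C the matrix X is unique: CA is injective on the
   column space of X by a rank count, and CAX is the orthogonal projector onto the
   column space of (CA)^k C. So the description below denotes. *)
definition BC_core_EP_inverse ::
  "complex ^ 'n ^ 'n \<Rightarrow> complex ^ 'n ^ 'n \<Rightarrow> complex ^ 'n ^ 'n \<Rightarrow> nat \<Rightarrow>
    complex ^ 'n ^ 'n" where
  "BC_core_EP_inverse A B C k = (THE X. is_BC_core_EP_inverse A B C k X)"

end

theory Submission
  imports Defs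
begin

text \<open>
  Put \<open>P = (CA)\<^sup>k C\<close>. The left ideal condition says \<open>ker X = ker P\<^sup>*\<close>, which is the orthogonal
  complement of the column space of \<open>P\<close>; together with \<open>C A X P = P\<close> this makes \<open>C A X\<close> the orthogonal
  projector onto the column space of \<open>P\<close>, with the same kernel as \<open>X\<close>. Hence \<open>CA\<close> is
  injective on the column space of \<open>X\<close>, which is the feasible set by the right ideal condition, and
  the claim is Pythagoras' theorem.
\<close>

lemma inner_complex_eq_Re_cnj_mult: "inner x y = Re (cnj x * y)"
  by (simp add: inner_complex_def)

text \<open>\<open>inner\<close> on complex vectors is the real inner product, the real part of the
  Hermitian one, so the conjugate transpose is the adjoint for it as well.\<close>

lemma inner_conj_transpose_matrix_vector_mult:
  "inner (conj_transpose P *v q) w = inner q (P *v w)"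
proof -
  \<comment> \<open>Removing \<open>times_complex.sel\<close> keeps \<open>Re\<close> of a product
    from splitting into real and imaginary parts.\<close>
  have "inner (conj_transpose P *v q) w = Re (\<Sum>i\<in>UNIV. \<Sum>j\<in>UNIV. P $ j $ i * cnj (q $ j) * w $ i)"
    by (simp add: inner_vec_def inner_complex_eq_Re_cnj_mult matrix_vector_mult_def
        conj_transpose_def sum_distrib_right del: times_complex.sel)
  also have "\<dots> = Re (\<Sum>j\<in>UNIV. \<Sum>i\<in>UNIV. P $ j $ i * cnj (q $ j) * w $ i)"
    by (subst sum.swap) simp
  also have "\<dots> = inner q (P *v w)"
    by (simp add: inner_vec_def inner_complex_eq_Re_cnj_mult matrix_vector_mult_def
        sum_distrib_left mult_ac del: times_complex.sel)
  finally show ?thesis .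
qed

text \<open>Real subspace structure suffices for the orthogonal decomposition and for closure under
  differences.\<close>

lemma subspace_mat_range: "subspace (mat_range P)"
  unfolding mat_range_def
proof (rule linear_subspace_image[OF _ subspace_UNIV])
  show "linear ((*v) P)"
    by (rule linearI)
      (simp_all add: vec_eq_iff matrix_vector_mult_def distrib_left sum.distrib scaleR_sum_right)
qed

lemma mat_range_orthogonal_decomp:
  obtains w q where "v = P *v w + q" "conj_transpose P *v q = 0"
proof -
  obtain y q where y: "y \<in> mat_range P" and q: "\<And>z. z \<in> mat_range P \<Longrightarrow> orthogonal q z"
    and v: "v = y + q"
    using orthogonal_subspace_decomp_exists[of "mat_range P" v]
      span_eq_iff[THEN iffD2, OF subspace_mat_range, of P]
    by metis
  obtain w where "y = P *v w"
    using y by (auto simp: mat_range_def)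
  \<comment> \<open>By adjointness this is the inner product of \<open>q\<close> with the image
    under \<open>P\<close> of \<open>conj_transpose P *v q\<close>, a vector of the column
    space.\<close>
  moreover have "inner (conj_transpose P *v q) (conj_transpose P *v q) = 0"
    using q unfolding inner_conj_transpose_matrix_vector_mult orthogonal_def mat_range_def by blast
  ultimately show ?thesis
    using that v by simp
qed

lemma mat_range_eq_if_right_ideal_of_eq:
  assumes "right_ideal_of X = right_ideal_of Q"
  shows "mat_range X = mat_range Q"
proof -
  \<comment> \<open>Stated for arbitrary matrices, so that it gives both inclusions.\<close>
  have "mat_range X \<subseteq> mat_range Q" if eq: "right_ideal_of X = right_ideal_of Q"
    for X Q :: "complex ^ 'n ^ 'n"
  proof -
    have "X \<in> right_ideal_of X"
      unfolding right_ideal_of_def by (metis matrix_mul_rid rangeI)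
    then obtain Y where "X = Q ** Y"
      unfolding eq by (auto simp: right_ideal_of_def)
    then show ?thesis
      by (auto simp: mat_range_def simp flip: matrix_vector_mul_assoc)
  qed
  then show ?thesis
    using assms by blast
qed

lemma ker_subset_if_left_ideal_of_eq:
  assumes "left_ideal_of X = left_ideal_of Q" "Q *v v = 0"
  shows "X *v v = 0"
proof -
  have "X \<in> left_ideal_of X"
    unfolding left_ideal_of_def by (metis matrix_mul_lid rangeI)
  then obtain Y where "X = Y ** Q"
    unfolding assms(1) by (auto simp: left_ideal_of_def)
  then show ?thesis
    using assms(2) by (simp flip: matrix_vector_mul_assoc)
qed

text \<open>The vectors \<open>w\<close> and \<open>q\<close> are chosen before \<open>Y\<close>:
  one decomposition of \<open>v\<close> serves all candidate inverses at once, which is what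
  uniqueness needs.\<close>

lemma BC_core_EP_inverse_decomp:
  obtains w q where "v = matrix_power (C ** A) k ** C *v w + q"
    "conj_transpose (matrix_power (C ** A) k ** C) *v q = 0"
    "\<And>Y. is_BC_core_EP_inverse A B C k Y \<Longrightarrow> Y *v q = 0"
    "\<And>Y. is_BC_core_EP_inverse A B C k Y \<Longrightarrow>
      C ** A *v (Y *v v) = matrix_power (C ** A) k ** C *v w"
proof -
  define P where "P = matrix_power (C ** A) k ** C"
  obtain w q where v: "v = P *v w + q" and q: "conj_transpose P *v q = 0"
    by (rule mat_range_orthogonal_decomp)
  have Yq: "Y *v q = 0" if "is_BC_core_EP_inverse A B C k Y" for Y
    using that q ker_subset_if_left_ideal_of_eq
    unfolding is_BC_core_EP_inverse_def P_def by blast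
  have "C ** A *v (Y *v v) = P *v w" if Y: "is_BC_core_EP_inverse A B C k Y" for Y
  proof -
    have "C ** A ** Y ** P = P"
      using Y by (simp add: is_BC_core_EP_inverse_def P_def matrix_mul_assoc)
    then show ?thesis
      using Yq[OF Y] by (simp add: v matrix_vector_right_distrib matrix_vector_mul_assoc matrix_mul_assoc)
  qed
  with that v q Yq show ?thesis
    unfolding P_def by blast
qed

text \<open>If \<open>CA\<close> kills \<open>X *v v\<close>, the component of \<open>v\<close> in
  the column space of \<open>(CA)^k C\<close> vanishes; the remaining component lies in the kernel
  of \<open>X\<close>.\<close>

lemma BC_core_EP_inverse_inj:
  assumes "is_BC_core_EP_inverse A B C k X"
    "C ** A *v x = C ** A *v y" "x \<in> mat_range X" "y \<in> mat_range X"
  shows "x = y"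
proof -
  have "x - y \<in> mat_range X"
    using assms(3,4) by (intro subspace_diff subspace_mat_range)
  then obtain v where v: "x - y = X *v v"
    by (auto simp: mat_range_def)
  obtain w q where "v = matrix_power (C ** A) k ** C *v w + q" "X *v q = 0"
    "C ** A *v (X *v v) = matrix_power (C ** A) k ** C *v w"
    using BC_core_EP_inverse_decomp[of v C A k B] assms(1) by metis
  moreover have "C ** A *v (X *v v) = 0"
    unfolding v[symmetric] using assms(2) by (simp add: matrix_vector_mult_diff_distrib)
  ultimately show ?thesis
    using v by simp
qed

text \<open>\<open>CAX\<close> and \<open>CAY\<close> are the same projector, and \<open>CA\<close>
  can be cancelled on the common column space of \<open>X\<close> and \<open>Y\<close>.\<close>

lemma is_BC_core_EP_inverse_unique:
  assumes X: "is_BC_core_EP_inverse A B C k X" and Y: "is_BC_core_EP_inverse A B C k Y"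
  shows "X = Y"
proof -
  have range: "mat_range Y = mat_range X"
    using X Y by (intro mat_range_eq_if_right_ideal_of_eq) (simp add: is_BC_core_EP_inverse_def)
  have "X *v v = Y *v v" for v
  proof (rule BC_core_EP_inverse_inj[OF X])
    show "C ** A *v (X *v v) = C ** A *v (Y *v v)"
      using BC_core_EP_inverse_decomp[of v C A k B] X Y by metis
    show "X *v v \<in> mat_range X"
      by (simp add: mat_range_def)
    show "Y *v v \<in> mat_range X"
      unfolding range[symmetric] by (simp add: mat_range_def)
  qed
  then show ?thesis
    by (simp add: matrix_eq)
qed

lemma is_BC_core_EP_inverse_BC_core_EP_inverse:
  assumes "k \<in> BC_core_EP_indices A B C"
  shows "is_BC_core_EP_inverse A B C k (BC_core_EP_inverse A B C k)"
  unfolding BC_core_EP_inverse_def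
  using assms by (auto simp: BC_core_EP_indices_def intro: theI is_BC_core_EP_inverse_unique)

text \<open>Both \<open>CAx\<close> and \<open>CAXb\<close> lie in the column space of
  \<open>(CA)^k C\<close>, to which the residual \<open>CAXb - b\<close> is orthogonal.\<close>

lemma BC_core_EP_inverse_pythagoras:
  assumes X: "is_BC_core_EP_inverse A B C k X" and x: "x \<in> mat_range X"
  shows "(norm (C ** A *v x - b))\<^sup>2 =
    (norm (C ** A *v x - C ** A *v (X *v b)))\<^sup>2 + (norm (C ** A *v (X *v b) - b))\<^sup>2"
proof -
  define P where "P = matrix_power (C ** A) k ** C"
  obtain v where v: "x = X *v v"
    using x by (auto simp: mat_range_def)
  obtain w where w: "C ** A *v x = P *v w"
    using BC_core_EP_inverse_decomp[of v C A k B] X unfolding P_def v by metis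
  obtain w' q where b: "b = P *v w' + q" and q: "conj_transpose P *v q = 0"
    and w': "C ** A *v (X *v b) = P *v w'"
    using BC_core_EP_inverse_decomp[of b C A k B] X unfolding P_def by metis
  have "inner q (P *v (w - w')) = 0"
    using q inner_conj_transpose_matrix_vector_mult[of P q "w - w'"] by simp
  \<comment> \<open>Here \<open>P *v w' - b\<close> is \<open>- q\<close>.\<close>
  then have "orthogonal (P *v w - P *v w') (P *v w' - b)"
    by (simp add: b orthogonal_def inner_commute matrix_vector_mult_diff_distrib)
  from norm_add_Pythagorean[OF this] show ?thesis
    by (simp add: w w')
qed

theorem theorem4p6:
  fixes A B C :: "complex ^ 'n ^ 'n" and k :: nat and b :: "complex ^ 'n"
  assumes "k \<in> BC_core_EP_indices A B C"
  shows "\<forall>x. is_arg_min (\<lambda>x. norm (C ** A *v x - b))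
               (\<lambda>x. x \<in> mat_range (matrix_power (C ** A) k ** B)) x
             \<longleftrightarrow> x = BC_core_EP_inverse A B C k *v b"
proof -
  define X where "X = BC_core_EP_inverse A B C k"
  have X: "is_BC_core_EP_inverse A B C k X"
    unfolding X_def using assms by (rule is_BC_core_EP_inverse_BC_core_EP_inverse)
  have range: "mat_range (matrix_power (C ** A) k ** B) = mat_range X"
    using X by (intro mat_range_eq_if_right_ideal_of_eq) (simp add: is_BC_core_EP_inverse_def)
  have Xb: "X *v b \<in> mat_range X"
    by (simp add: mat_range_def)
  have min: "norm (C ** A *v (X *v b) - b) \<le> norm (C ** A *v x - b)" if "x \<in> mat_range X" for x
    using BC_core_EP_inverse_pythagoras[OF X that, of b] by (simp add: power2_le_imp_le)
  have uniq: "x = X *v b"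
    if x: "x \<in> mat_range X" and le: "norm (C ** A *v x - b) \<le> norm (C ** A *v (X *v b) - b)" for x
  proof (rule BC_core_EP_inverse_inj[OF X _ x Xb])
    \<comment> \<open>In the Pythagorean identity this forces the first square on the right to be
      zero.\<close>
    have "(norm (C ** A *v x - b))\<^sup>2 \<le> (norm (C ** A *v (X *v b) - b))\<^sup>2"
      using le by (intro power_mono) auto
    then show "C ** A *v x = C ** A *v (X *v b)"
      using BC_core_EP_inverse_pythagoras[OF X x, of b] by simp
  qed
  show ?thesis
    unfolding X_def[symmetric] range is_arg_min_linorder using Xb min uniq by blast
qed

end
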